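(* Let $X$ be a set, let $b:X\times X\to[-\infty,+\infty)$ be a kernel, and let $\bar B$ be the operator $\bar B f(x)=\sup_{y\in X} b(x,y)-_\bot f(y)$ for $f\in\overline{\mathbb R}^X$, $x\in X$. The following statements are equivalent: (i) $b$ is tpsd, i.e. symmetric and such that $b(x,x)+b(y,y)\ge b(x,y)+b(y,x)$ for all $x,y\in X$; (ii) for all integers $M\ge 1$, all $(x_m)_{1\le m\le M}\in X^M$ and all permutations $\sigma$ of $\{1,\dots,M\}$, the Gram matrix $[b(x_n,x_m)]_{1\le n,m\le M}$ is symmetric and $$\sum_{m=1}^M b(x_m,x_m)\ \ge\ \sum_{m=1}^M b(x_m,x_{\sigma(m)});$$ (iii) $\bar B$ is hermitian and, for all $\hat f,\hat g\in\overline{\mathbb R}^X$, $$\langle \hat f,\bar B\hat f\rangle +_\top\langle\hat g,\bar B\hat g\rangle\ \ge\ \langle\hat f,\bar B\hat g\rangle+_\bot\langle\hat g,\bar B\hat f\rangle;$$ (iv) $\bar B$ is hermitian, for all $\hat f,\hat g\in\overline{\mathbb R}^X$, $$\max\big(\langle \hat f,\bar B\hat f\rangle,\langle\hat g,\bar B\hat g\rangle\big)\ \ge\ \langle\hat f,\bar B\hat g\rangle,$$ and, for any $x\in X$, $b(x,x)=-\infty$ implies that $b(x,y)=-\infty$ for all $y\in X$; (v) $\bar B$ is hermitian and, for all integers $M\ge1$ and all $(\hat f_m)_{1\le m\le M}$ in $\overline{\mathbb R}^X$, with the convention $\hat f_{M+1}=\hat f_1$, $$\sum_{m=1}^M\langle\hat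 f_m,\bar B\hat f_m\rangle\ \ge\ \sum_{m=1}^M\langle\hat f_m,\bar B\hat f_{m+1}\rangle,$$ where the left-hand sum is computed with $+_\top$ and the right-hand sum with $+_\bot$; (vi) $\bar B$ is hermitian, for all integers $M\ge1$ and all $(\hat f_m)_{1\le m\le M}$ in $\overline{\mathbb R}^X$, with the convention $\hat f_{M+1}=\hat f_1$, $$\max_{1\le m\le M}\langle\hat f_m,\bar B\hat f_m\rangle\ \ge\ \max_{1\le m\le M}\langle\hat f_m,\bar B\hat f_{m+1}\rangle,$$ and, for any $x\in X$, $b(x,x)=-\infty$ implies that $b(x,y)=-\infty$ for all $y\in X$.
   Context: $\overline{\mathbb R}=[-\infty,+\infty]$. The operation $+_\top$ (upper addition) extends the usual addition to $\overline{\mathbb R}$ with $+\infty$ absorbing; $+_\bot$ (lower addition) extends it with $-\infty$ absorbing; $a-_\bot c:=a+_\bot(-c)$. The duality product is $\langle\hat g,f\rangle:=\sup_{x\in X} f(x)-_\bot\hat g(x)$ for $\hat g,f\in\overline{\mathbb R}^X$. The operator $\bar B$ is called hermitian if $\langle\hat g,\bar B\hat f\rangle=\langle\hat f,\bar B\hat g\rangle$ for all $\hat f,\hat g\in\overline{\mathbb R}^X$. *)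

theory Defs
  imports "HOL-Library.Extended_Real" "HOL-Combinatorics.Permutations"
begin

(* The addition of type ereal already has \<infinity> absorbing (see plus_ereal.simps), i.e. it
   is the upper addition; consequently the library's finite sums over ereal are upper sums. *)
abbreviation upper_add :: "ereal \<Rightarrow> ereal \<Rightarrow> ereal" (infixl "+\<^sub>\<top>" 65)
  where "a +\<^sub>\<top> c \<equiv> a + c"

definition lower_add :: "ereal \<Rightarrow> ereal \<Rightarrow> ereal" (infixl "+\<^sub>\<bottom>" 65)
  where "a +\<^sub>\<bottom> c = (if a = -\<infinity> \<or> c = -\<infinity> then -\<infinity> else a + c)"

definition lower_minus :: "ereal \<Rightarrow> ereal \<Rightarrow> ereal" (infixl "-\<^sub>\<bottom>" 65)
  where "a -\<^sub>\<bottom> c = a +\<^sub>\<bottom> (- c)"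

lemma comm_monoid_set_lower_add: "comm_monoid_set lower_add 0"
proof
  fix a c d :: ereal
  show "a +\<^sub>\<bottom> c +\<^sub>\<bottom> d = a +\<^sub>\<bottom> (c +\<^sub>\<bottom> d)"
    by (cases a; cases c; cases d) (simp_all add: lower_add_def)
  show "a +\<^sub>\<bottom> c = c +\<^sub>\<bottom> a"
    by (simp add: lower_add_def add.commute)
  show "a +\<^sub>\<bottom> 0 = a"
    by (simp add: lower_add_def)
qed

definition lower_sum :: "('i \<Rightarrow> ereal) \<Rightarrow> 'i set \<Rightarrow> ereal"
  where "lower_sum = comm_monoid_set.F lower_add 0"

interpretation lower_sum: comm_monoid_set lower_add 0
  rewrites "comm_monoid_set.F lower_add 0 = lower_sum"
  by (rule comm_monoid_set_lower_add) (simp add: lower_sum_def)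

(* Functions on X are represented by total functions on the ambient type; every notion below
   (and hence every quantification over such functions) depends only on the values on X. *)

definition tpsd :: "'a set \<Rightarrow> ('a \<Rightarrow> 'a \<Rightarrow> ereal) \<Rightarrow> bool"
  where "tpsd X b \<longleftrightarrow>
    (\<forall>x\<in>X. \<forall>y\<in>X. b x y = b y x) \<and>
    (\<forall>x\<in>X. \<forall>y\<in>X. b x x + b y y \<ge> b x y + b y x)"

definition kernel_op :: "'a set \<Rightarrow> ('a \<Rightarrow> 'a \<Rightarrow> ereal) \<Rightarrow> ('a \<Rightarrow> ereal) \<Rightarrow> 'a \<Rightarrow> ereal"
  where "kernel_op X b f x = (SUP y\<in>X. b x y -\<^sub>\<bottom> f y)"

(* The first argument is the one that is subtracted. *)
definition duality_prod :: "'a set \<Rightarrow> ('a \<Rightarrow> ereal) \<Rightarrow> ('a \<Rightarrow> ereal) \<Rightarrow> ereal"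
  where "duality_prod X g f = (SUP x\<in>X. f x -\<^sub>\<bottom> g x)"

definition hermitian :: "'a set \<Rightarrow> (('a \<Rightarrow> ereal) \<Rightarrow> ('a \<Rightarrow> ereal)) \<Rightarrow> bool"
  where "hermitian X B \<longleftrightarrow> (\<forall>f g. duality_prod X g (B f) = duality_prod X f (B g))"

end

theory Submission
  imports Defs
begin

text \<open>
  Lower subtraction is residuated by upper addition: \<open>a -\<^sub>\<bottom> c \<le> d\<close> iff \<open>a \<le> d + c\<close>, with
  no finiteness condition. Hence the number \<open>\<langle>f, B g\<rangle>\<close> is characterised by its upper
  bounds: it is below \<open>c\<close> iff \<open>b x y \<le> c + (f x + g y)\<close> for all \<open>x\<close>, \<open>y\<close>. All suprema and
  infinite values are handled through this equivalence.

  If \<open>b\<close> is tpsd, then \<open>b x x \<le> \<langle>f, B f\<rangle> + 2 f x\<close> and \<open>b y y \<le> \<langle>g, B g\<rangle> + 2 g y\<close> add up to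
  \<open>2 b x y \<le> \<langle>f, B f\<rangle> + \<langle>g, B g\<rangle> + 2 (f x + g y)\<close>, and halving gives the
  inequality \<open>2 \<langle>f, B g\<rangle> \<le> \<langle>f, B f\<rangle> + \<langle>g, B g\<rangle>\<close> (lemma
  \<open>tpsd_duality_double_le\<close>). So \<open>B\<close> inherits on functions exactly the inequality that \<open>b\<close>
  satisfies on points. Summing it along a permutation, where every diagonal term
  occurs twice on the right, and halving again gives the inequalities for sums
  (lemma \<open>lower_sum_le_of_double_le\<close>); bounding the two diagonal terms by their maximum gives
  those for maxima.

  Conversely, functions equal to a real \<open>l\<close> at one point \<open>x\<close> and to \<open>\<infinity>\<close> elsewhere recover the
  kernel: two such functions pair to \<open>b x y - (l + m)\<close>. With \<open>l = m = 0\<close>,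
  hermitianity gives the symmetry of \<open>b\<close>, and the sum inequality for two functions gives the
  inequality on \<open>b\<close>. The maximum inequality needs in addition a choice of \<open>l\<close> and \<open>m = - l\<close> that makes both
  diagonal terms equal to the mean of \<open>b x x\<close> and \<open>b y y\<close>, which requires these to be finite;
  this is why the clause on \<open>b x x = -\<infinity>\<close> appears in the statements with maxima.
\<close>

section \<open>Arithmetic of extended reals\<close>

lemma lower_minus_le_iff: "a -\<^sub>\<bottom> c \<le> d \<longleftrightarrow> a \<le> d + c"
  by (cases a; cases c; cases d) (auto simp: lower_minus_def lower_add_def)

lemma lower_add_self: "a +\<^sub>\<bottom> a = a + a"
  by (cases a) (simp_all add: lower_add_def)

lemma lower_add_le_add: "a +\<^sub>\<bottom> c \<le> a + c"
  by (simp add: lower_add_def)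

lemma lower_add_eq_add: "a < \<infinity> \<Longrightarrow> c < \<infinity> \<Longrightarrow> a +\<^sub>\<bottom> c = a + c"
  by (cases a; cases c) (auto simp: lower_add_def)

lemma ereal_double_le_cancel:
  fixes a c :: ereal
  assumes "a + a \<le> c + c"
  shows "a \<le> c"
  using assms by (cases a; cases c) auto

lemma ereal_half_exists:
  fixes s :: ereal
  obtains h where "h + h = s"
proof (cases s)
  case (real r)
  then have "ereal (r / 2) + ereal (r / 2) = s" by simp
  then show thesis by (rule that)
qed (use that[of \<infinity>] that[of "-\<infinity>"] in auto)

lemma lower_sum_le_sum: "finite I \<Longrightarrow> lower_sum t I \<le> sum t I"
proof (induction I rule: finite_induct)
  case (insert i I)
  have "t i +\<^sub>\<bottom> lower_sum t I \<le> t i + lower_sum t I"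
    by (rule lower_add_le_add)
  also have "\<dots> \<le> t i + sum t I"
    using insert.IH by (rule add_left_mono)
  finally show ?case
    using insert.hyps by simp
qed simp

text \<open>
  The hypothesis that \<open>d\<close> and \<open>e\<close> have the same sum is met when \<open>e\<close> is a rearrangement of \<open>d\<close>.
  Adding the hypotheses gives the conclusion with both sides doubled.
\<close>

lemma sum_le_of_double_le:
  fixes t d e :: "'i \<Rightarrow> ereal"
  assumes "\<And>i. i \<in> I \<Longrightarrow> t i + t i \<le> d i + e i" and "sum e I = sum d I"
  shows "sum t I \<le> sum d I"
proof (rule ereal_double_le_cancel)
  have "sum t I + sum t I \<le> sum d I + sum e I"
    unfolding sum.distrib[symmetric] using assms(1) by (rule sum_mono)
  then show "sum t I + sum t I \<le> sum d I + sum d I"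
    using assms(2) by simp
qed

lemma lower_sum_le_of_double_le:
  fixes t d e :: "'i \<Rightarrow> ereal"
  assumes "finite I" "\<And>i. i \<in> I \<Longrightarrow> t i + t i \<le> d i + e i" "sum e I = sum d I"
  shows "lower_sum t I \<le> sum d I"
  using lower_sum_le_sum[OF assms(1)] sum_le_of_double_le[OF assms(2,3)] by (rule order_trans)

lemma atLeastAtMost_1_2: "{1..2} = {1, 2::nat}"
  by auto

lemma sum_cyclic_shift:
  fixes d :: "nat \<Rightarrow> 'b::comm_monoid_add"
  assumes "M \<ge> 1" "d (M + 1) = d 1"
  shows "(\<Sum>m=1..M. d (m + 1)) = (\<Sum>m=1..M. d m)"
proof -
  have "(\<Sum>m=1..M. d (m + 1)) = (\<Sum>m=Suc 1..Suc M. d m)"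
    unfolding sum.shift_bounds_cl_Suc_ivl by simp
  also have "\<dots> = (\<Sum>m=Suc 1..M. d m) + d 1"
    using assms by (simp add: sum.nat_ivl_Suc' add.commute)
  also have "\<dots> = (\<Sum>m=1..M. d m)"
    using assms(1) by (simp add: sum.atLeast_Suc_atMost add.commute)
  finally show ?thesis .
qed

section \<open>Duality products with a kernel operator\<close>

text \<open>
  The residuation law applied to the two nested suprema. Together with antisymmetry it
  replaces any computation with these suprema.
\<close>

lemma duality_kernel_le_iff:
  "duality_prod X f (kernel_op X b g) \<le> c \<longleftrightarrow> (\<forall>x\<in>X. \<forall>y\<in>X. b x y \<le> c + (f x + g y))"
  by (simp add: duality_prod_def kernel_op_def SUP_le_iff lower_minus_le_iff add.assoc)

lemma kernel_le_duality_kernel: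
  assumes "x \<in> X" "y \<in> X"
  shows "b x y \<le> duality_prod X f (kernel_op X b g) + (f x + g y)"
  using assms duality_kernel_le_iff[of X f b g "duality_prod X f (kernel_op X b g)"] by simp

definition peak :: "'a \<Rightarrow> ereal \<Rightarrow> 'a \<Rightarrow> ereal"
  where "peak x l = (\<lambda>z. if z = x then l else \<infinity>)"

lemma duality_kernel_peak:
  assumes "x \<in> X" "y \<in> X"
  shows "duality_prod X (peak x (ereal l)) (kernel_op X b (peak y (ereal m))) = b x y - ereal (l + m)"
proof -
  have "duality_prod X (peak x (ereal l)) (kernel_op X b (peak y (ereal m))) \<le> c
      \<longleftrightarrow> b x y - ereal (l + m) \<le> c" for c
  proof -
    have "duality_prod X (peak x (ereal l)) (kernel_op X b (peak y (ereal m))) \<le> c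
        \<longleftrightarrow> b x y \<le> c + ereal (l + m)"
      using assms by (auto simp: duality_kernel_le_iff peak_def)
    also have "\<dots> \<longleftrightarrow> b x y - ereal (l + m) \<le> c"
      by (simp add: ereal_minus_le)
    finally show ?thesis .
  qed
  then show ?thesis
    by (meson order_antisym order_refl)
qed

lemma duality_kernel_peak_zero:
  assumes "x \<in> X" "y \<in> X"
  shows "duality_prod X (peak x 0) (kernel_op X b (peak y 0)) = b x y"
  using duality_kernel_peak[OF assms, of 0 b 0] by (simp add: zero_ereal_def[symmetric])

lemma hermitian_kernel_op_iff:
  "hermitian X (kernel_op X b) \<longleftrightarrow> (\<forall>x\<in>X. \<forall>y\<in>X. b x y = b y x)"
proof
  assume "hermitian X (kernel_op X b)"
  then show "\<forall>x\<in>X. \<forall>y\<in>X. b x y = b y x"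
    unfolding hermitian_def using duality_kernel_peak_zero by metis
next
  assume sym: "\<forall>x\<in>X. \<forall>y\<in>X. b x y = b y x"
  have le: "duality_prod X g (kernel_op X b f) \<le> duality_prod X f (kernel_op X b g)" for f g
  proof -
    have "b x y \<le> duality_prod X f (kernel_op X b g) + (g x + f y)" if "x \<in> X" "y \<in> X" for x y
    proof -
      have "b y x \<le> duality_prod X f (kernel_op X b g) + (f y + g x)"
        using that(2,1) by (rule kernel_le_duality_kernel)
      moreover have "b x y = b y x"
        using sym that by blast
      ultimately show ?thesis
        by (simp only: add.commute)
    qed
    then show ?thesis
      by (simp add: duality_kernel_le_iff)
  qed
  show "hermitian X (kernel_op X b)"
    unfolding hermitian_def by (intro allI order_antisym le)
qed

section \<open>Inequalities for a tpsd kernel\<close>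

lemma tpsd_double_le:
  assumes "tpsd X b" "x \<in> X" "y \<in> X"
  shows "b x y + b x y \<le> b x x + b y y"
proof -
  have "b x y = b y x" "b x y + b y x \<le> b x x + b y y"
    using assms unfolding tpsd_def by blast+
  then show ?thesis by simp
qed

lemma tpsd_hermitian: "tpsd X b \<Longrightarrow> hermitian X (kernel_op X b)"
  unfolding hermitian_kernel_op_iff tpsd_def by blast

text \<open>
  The tpsd inequality passes from points to functions. Let \<open>h\<close> be half of
  \<open>\<langle>f, B f\<rangle> + \<langle>g, B g\<rangle>\<close>. By \<open>duality_kernel_le_iff\<close>, proving \<open>\<langle>f, B g\<rangle> \<le> h\<close> amounts to bounding
  each \<open>b x y\<close> by \<open>h + (f x + g y)\<close>, and twice this bound is the sum of the bounds on \<open>b x x\<close>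
  and \<open>b y y\<close>.
\<close>

lemma tpsd_duality_double_le:
  fixes f g :: "'a \<Rightarrow> ereal"
  assumes "tpsd X b"
  defines "P \<equiv> \<lambda>f g. duality_prod X f (kernel_op X b g)"
  shows "P f g + P f g \<le> P f f + P g g"
proof -
  obtain h where h: "h + h = P f f + P g g"
    by (rule ereal_half_exists)
  have diag: "b z z \<le> P u u + (u z + u z)" if "z \<in> X" for z u
    unfolding P_def using that that by (rule kernel_le_duality_kernel)
  have "b x y \<le> h + (f x + g y)" if "x \<in> X" "y \<in> X" for x y
  proof (rule ereal_double_le_cancel)
    have "b x y + b x y \<le> b x x + b y y"
      using assms(1) that by (rule tpsd_double_le)
    also have "\<dots> \<le> (P f f + (f x + f x)) + (P g g + (g y + g y))"
      using that by (intro add_mono diag)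
    also have "\<dots> = (P f f + P g g) + ((f x + g y) + (f x + g y))"
      by (simp only: ac_simps)
    also have "\<dots> = (h + (f x + g y)) + (h + (f x + g y))"
      unfolding h[symmetric] by (simp only: ac_simps)
    finally show "b x y + b x y \<le> (h + (f x + g y)) + (h + (f x + g y))" .
  qed
  then have "P f g \<le> h"
    unfolding P_def by (simp add: duality_kernel_le_iff)
  then have "P f g + P f g \<le> h + h"
    by (intro add_mono)
  then show ?thesis
    by (simp only: h)
qed

lemma tpsd_duality_le_max:
  fixes f g :: "'a \<Rightarrow> ereal"
  assumes "tpsd X b"
  defines "P \<equiv> \<lambda>f g. duality_prod X f (kernel_op X b g)"
  shows "P f g \<le> max (P f f) (P g g)"
proof (rule ereal_double_le_cancel)
  have "P f g + P f g \<le> P f f + P g g"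
    unfolding P_def by (rule tpsd_duality_double_le[OF assms(1)])
  also have "\<dots> \<le> max (P f f) (P g g) + max (P f f) (P g g)"
    by (intro add_mono max.cobounded1 max.cobounded2)
  finally show "P f g + P f g \<le> max (P f f) (P g g) + max (P f f) (P g g)" .
qed

lemma tpsd_minf_row:
  assumes "tpsd X b" "x \<in> X" "y \<in> X" "b y y < \<infinity>" "b x x = -\<infinity>"
  shows "b x y = -\<infinity>"
proof -
  have "b x y + b x y \<le> -\<infinity>"
    using tpsd_double_le[OF assms(1-3)] assms(4,5) by (cases "b y y") auto
  then show ?thesis by (cases "b x y") auto
qed

lemma tpsd_sum_permutation_le:
  assumes "tpsd X b" "x \<in> I \<rightarrow> X" "\<sigma> permutes I"
  shows "(\<Sum>m\<in>I. b (x m) (x (\<sigma> m))) \<le> (\<Sum>m\<in>I. b (x m) (x m))"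
proof (rule sum_le_of_double_le)
  show "b (x i) (x (\<sigma> i)) + b (x i) (x (\<sigma> i))
      \<le> b (x i) (x i) + b (x (\<sigma> i)) (x (\<sigma> i))" if "i \<in> I" for i
    using that assms by (intro tpsd_double_le) (auto simp: permutes_in_image)
  show "(\<Sum>i\<in>I. b (x (\<sigma> i)) (x (\<sigma> i))) = (\<Sum>m\<in>I. b (x m) (x m))"
    using sum.permute[OF assms(3), of "\<lambda>i. b (x i) (x i)"] by (simp add: comp_def)
qed

lemma tpsd_duality_cyclic_sum_le:
  fixes f :: "nat \<Rightarrow> 'a \<Rightarrow> ereal"
  assumes "tpsd X b" "M \<ge> 1" "f (M + 1) = f 1"
  shows "lower_sum (\<lambda>m. duality_prod X (f m) (kernel_op X b (f (m + 1)))) {1..M}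
    \<le> (\<Sum>m=1..M. duality_prod X (f m) (kernel_op X b (f m)))"
proof -
  let ?d = "\<lambda>m. duality_prod X (f m) (kernel_op X b (f m))"
  have "(\<Sum>m=1..M. ?d (m + 1)) = (\<Sum>m=1..M. ?d m)"
    by (rule sum_cyclic_shift[where d = ?d]) (simp_all only: assms(2,3))
  with finite_atLeastAtMost tpsd_duality_double_le[OF assms(1)] show ?thesis
    by (rule lower_sum_le_of_double_le)
qed

lemma Max_cyclic_le:
  fixes t d :: "nat \<Rightarrow> 'b::linorder"
  assumes "M \<ge> 1" "d (M + 1) = d 1"
    and "\<And>m. m \<in> {1..M} \<Longrightarrow> t m \<le> max (d m) (d (m + 1))"
  shows "(MAX m\<in>{1..M}. t m) \<le> (MAX m\<in>{1..M}. d m)"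
proof -
  let ?D = "MAX m\<in>{1..M}. d m"
  have d_le: "d m \<le> ?D" if "m \<in> {1..M}" for m
    using that by (intro Max_ge finite_imageI finite_atLeastAtMost imageI)
  have d_Suc_le: "d (m + 1) \<le> ?D" if "m \<in> {1..M}" for m
  proof (cases "m = M")
    case True
    have "d 1 \<le> ?D"
      using assms(1) by (intro d_le) simp
    then show ?thesis
      unfolding True assms(2) .
  next
    case False
    then show ?thesis
      using that by (intro d_le) simp
  qed
  show ?thesis
  proof (rule Max.boundedI)
    fix a
    assume "a \<in> t ` {1..M}"
    then obtain m where m: "m \<in> {1..M}" "a = t m"
      by (rule imageE)
    have "t m \<le> max (d m) (d (m + 1))"
      using m(1) by (rule assms(3))
    also have "\<dots> \<le> ?D"
      using m(1) by (intro max.boundedI d_le d_Suc_le)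
    finally show "a \<le> ?D"
      using m(2) by simp
  qed (use assms(1) in simp_all)
qed

section \<open>Criteria for a kernel to be tpsd\<close>

lemma tpsdI_permutation:
  assumes perm: "\<And>x \<sigma>. x \<in> {1..2} \<rightarrow> X \<Longrightarrow> \<sigma> permutes {1..2::nat} \<Longrightarrow>
      (\<forall>n\<in>{1..2}. \<forall>m\<in>{1..2}. b (x n) (x m) = b (x m) (x n)) \<and>
      (\<Sum>m=1..2. b (x m) (x (\<sigma> m))) \<le> (\<Sum>m=1..2. b (x m) (x m))"
  shows "tpsd X b"
proof -
  have "b x y = b y x \<and> b x y + b y x \<le> b x x + b y y" if "x \<in> X" "y \<in> X" for x y
  proof -
    let ?p = "\<lambda>m::nat. if m = 1 then x else y"
    have "?p \<in> {1..2} \<rightarrow> X"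
      using that by simp
    moreover have "Transposition.transpose 1 2 permutes {1..2::nat}"
      by (rule permutes_swap_id) simp_all
    ultimately have sym: "\<forall>n\<in>{1..2}. \<forall>m\<in>{1..2}. b (?p n) (?p m) = b (?p m) (?p n)"
      and le: "(\<Sum>m=1..2. b (?p m) (?p (Transposition.transpose 1 2 m)))
        \<le> (\<Sum>m=1..2. b (?p m) (?p m))"
      using perm by blast+
    have "b x y = b y x"
      using sym[rule_format, of 1 2] by simp
    moreover have "b x y + b y x \<le> b x x + b y y"
      using le unfolding atLeastAtMost_1_2 by simp
    ultimately show ?thesis ..
  qed
  then show ?thesis unfolding tpsd_def by blast
qed

lemma tpsdI_duality_sum:
  fixes b :: "'a \<Rightarrow> 'a \<Rightarrow> ereal"
  assumes "\<And>x y. x \<in> X \<Longrightarrow> y \<in> X \<Longrightarrow> b x y < \<infinity>"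
  defines "P \<equiv> \<lambda>f g. duality_prod X f (kernel_op X b g)"
  assumes "hermitian X (kernel_op X b)"
    and "\<And>f g. P f g +\<^sub>\<bottom> P g f \<le> P f f + P g g"
  shows "tpsd X b"
proof -
  have "b x y + b y x \<le> b x x + b y y" if "x \<in> X" "y \<in> X" for x y
    using assms(4)[of "peak x 0" "peak y 0"] assms(1) that
    by (simp add: P_def duality_kernel_peak_zero lower_add_eq_add)
  then show ?thesis
    using assms(3) unfolding tpsd_def hermitian_kernel_op_iff by blast
qed

text \<open>
  A bound by the maximum of two numbers becomes a bound by their mean once the two numbers are
  made equal. Lowering one peak and raising the other by the same amount does
  this: it moves \<open>b x x\<close> and \<open>b y y\<close> in opposite directions and keeps \<open>b x y\<close> fixed.
\<close>

lemma tpsdI_duality_max: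
  fixes b :: "'a \<Rightarrow> 'a \<Rightarrow> ereal"
  assumes "\<And>x y. x \<in> X \<Longrightarrow> y \<in> X \<Longrightarrow> b x y < \<infinity>"
  defines "P \<equiv> \<lambda>f g. duality_prod X f (kernel_op X b g)"
  assumes "hermitian X (kernel_op X b)"
    and le_max: "\<And>f g. P f g \<le> max (P f f) (P g g)"
    and minf_row: "\<And>x y. x \<in> X \<Longrightarrow> y \<in> X \<Longrightarrow> b x x = -\<infinity> \<Longrightarrow> b x y = -\<infinity>"
  shows "tpsd X b"
proof -
  have sym: "b x y = b y x" if "x \<in> X" "y \<in> X" for x y
    using assms(3) that unfolding hermitian_kernel_op_iff by blast
  have "b x y + b y x \<le> b x x + b y y" if xy: "x \<in> X" "y \<in> X" for x y
  proof (cases "b x x = -\<infinity> \<or> b y y = -\<infinity>")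
    case True
    then have "b x y = -\<infinity>"
      using minf_row xy sym by metis
    then show ?thesis using sym[OF xy] by simp
  next
    case False
    then obtain p q where p: "b x x = ereal p" and q: "b y y = ereal q"
      using assms(1)[OF xy(1,1)] assms(1)[OF xy(2,2)] by (cases "b x x"; cases "b y y") auto
    \<comment> \<open>The solution of \<open>p - 2 * l = q + 2 * l\<close>.\<close>
    define l where "l = (p - q) / 4"
    have "b x y \<le> max (ereal (p - 2 * l)) (ereal (q + 2 * l))"
      using le_max[of "peak x (ereal l)" "peak y (ereal (- l))"] xy
      by (simp add: P_def duality_kernel_peak p q zero_ereal_def[symmetric])
    also have "\<dots> = ereal ((p + q) / 2)"
      by (simp add: l_def field_simps)
    finally have "b x y + b x y \<le> ereal ((p + q) / 2) + ereal ((p + q) / 2)"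
      by (intro add_mono)
    then show ?thesis
      using sym[OF xy] p q by simp
  qed
  then show ?thesis
    using sym unfolding tpsd_def by blast
qed

section \<open>The equivalences\<close>

text \<open>
  The statements about \<open>M\<close> functions give those about two functions by taking \<open>M = 2\<close> and
  the cycle \<open>f, g, f\<close>.
\<close>

theorem proposition4p1:
  fixes X :: "'a set" and b :: "'a \<Rightarrow> 'a \<Rightarrow> ereal"
  assumes "\<And>x y. x \<in> X \<Longrightarrow> y \<in> X \<Longrightarrow> b x y < \<infinity>"
  defines "B \<equiv> kernel_op X b"
  shows
    "(tpsd X b \<longleftrightarrow>
        (\<forall>M\<ge>1. \<forall>x \<in> {1..M} \<rightarrow> X. \<forall>\<sigma>. \<sigma> permutes {1..M} \<longrightarrow>
          (\<forall>n\<in>{1..M}. \<forall>m\<in>{1..M}. b (x n) (x m) = b (x m) (x n)) \<and>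
          (\<Sum>m=1..M. b (x m) (x m)) \<ge> (\<Sum>m=1..(M::nat). b (x m) (x (\<sigma> m)))))
     \<and>
     (tpsd X b \<longleftrightarrow>
        hermitian X B \<and>
        (\<forall>f g. duality_prod X f (B f) +\<^sub>\<top> duality_prod X g (B g)
               \<ge> duality_prod X f (B g) +\<^sub>\<bottom> duality_prod X g (B f)))
     \<and>
     (tpsd X b \<longleftrightarrow>
        hermitian X B \<and>
        (\<forall>f g. max (duality_prod X f (B f)) (duality_prod X g (B g)) \<ge> duality_prod X f (B g)) \<and>
        (\<forall>x\<in>X. b x x = -\<infinity> \<longrightarrow> (\<forall>y\<in>X. b x y = -\<infinity>)))
     \<and>
     (tpsd X b \<longleftrightarrow>
        hermitian X B \<and>
        (\<forall>M\<ge>1. \<forall>f :: nat \<Rightarrow> 'a \<Rightarrow> ereal. f (M + 1) = f 1 \<longrightarrow>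
          (\<Sum>m=1..M. duality_prod X (f m) (B (f m)))
          \<ge> lower_sum (\<lambda>m. duality_prod X (f m) (B (f (m + 1)))) {1..M}))
     \<and>
     (tpsd X b \<longleftrightarrow>
        hermitian X B \<and>
        (\<forall>M\<ge>1. \<forall>f :: nat \<Rightarrow> 'a \<Rightarrow> ereal. f (M + 1) = f 1 \<longrightarrow>
          (MAX m\<in>{1..M}. duality_prod X (f m) (B (f m)))
          \<ge> (MAX m\<in>{1..M}. duality_prod X (f m) (B (f (m + 1))))) \<and>
        (\<forall>x\<in>X. b x x = -\<infinity> \<longrightarrow> (\<forall>y\<in>X. b x y = -\<infinity>)))"
proof -
  let ?P = "\<lambda>f g. duality_prod X f (B g)"
  have minf: "\<forall>x\<in>X. b x x = -\<infinity> \<longrightarrow> (\<forall>y\<in>X. b x y = -\<infinity>)" if "tpsd X b"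
    using tpsd_minf_row[OF that] assms(1) by blast
  have herm: "hermitian X B" if "tpsd X b"
    using tpsd_hermitian[OF that] by (simp add: B_def)
  have le_max: "?P f g \<le> max (?P f f) (?P g g)" if "tpsd X b" for f g
    unfolding B_def using that by (rule tpsd_duality_le_max)
  have from_sum: "tpsd X b" if "hermitian X B" "\<And>f g. ?P f g +\<^sub>\<bottom> ?P g f \<le> ?P f f + ?P g g"
    using assms(1) that unfolding B_def by (rule tpsdI_duality_sum)
  have from_max: "tpsd X b" if "hermitian X B" "\<And>f g. ?P f g \<le> max (?P f f) (?P g g)"
    "\<forall>x\<in>X. b x x = -\<infinity> \<longrightarrow> (\<forall>y\<in>X. b x y = -\<infinity>)"
    by (rule tpsdI_duality_max[OF assms(1) that(1,2)[unfolded B_def] that(3)[rule_format]])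

  have i_ii: "tpsd X b \<longleftrightarrow> (\<forall>M\<ge>1. \<forall>x \<in> {1..M} \<rightarrow> X. \<forall>\<sigma>. \<sigma> permutes {1..M} \<longrightarrow>
      (\<forall>n\<in>{1..M}. \<forall>m\<in>{1..M}. b (x n) (x m) = b (x m) (x n)) \<and>
      (\<Sum>m=1..M. b (x m) (x m)) \<ge> (\<Sum>m=1..(M::nat). b (x m) (x (\<sigma> m))))" (is "_ \<longleftrightarrow> ?ii")
  proof
    assume tpsd: "tpsd X b"
    have "(\<forall>n\<in>{1..M}. \<forall>m\<in>{1..M}. b (x n) (x m) = b (x m) (x n)) \<and>
        (\<Sum>m=1..M. b (x m) (x m)) \<ge> (\<Sum>m=1..M. b (x m) (x (\<sigma> m)))"
      if x: "x \<in> {1..M} \<rightarrow> X" and perm: "\<sigma> permutes {1..M}" for x \<sigma> and M :: nat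
    proof (intro conjI ballI)
      show "b (x n) (x m) = b (x m) (x n)" if "n \<in> {1..M}" "m \<in> {1..M}" for n m
        using tpsd funcset_mem[OF x that(1)] funcset_mem[OF x that(2)]
        unfolding tpsd_def by blast
      show "(\<Sum>m=1..M. b (x m) (x (\<sigma> m))) \<le> (\<Sum>m=1..M. b (x m) (x m))"
        using tpsd x perm by (rule tpsd_sum_permutation_le)
    qed
    then show ?ii by (intro allI impI ballI)
  next
    assume ii: ?ii
    show "tpsd X b"
      by (rule tpsdI_permutation) (rule ii[rule_format, OF one_le_numeral])
  qed

  have i_iii: "tpsd X b \<longleftrightarrow> hermitian X B \<and> (\<forall>f g. ?P f f + ?P g g \<ge> ?P f g +\<^sub>\<bottom> ?P g f)"
    (is "_ \<longleftrightarrow> ?iii")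
  proof
    assume tpsd: "tpsd X b"
    have "?P f g +\<^sub>\<bottom> ?P g f \<le> ?P f f + ?P g g" for f g
    proof -
      have "?P g f = ?P f g"
        using herm[OF tpsd] by (simp add: hermitian_def)
      then show ?thesis
        using tpsd_duality_double_le[OF tpsd] by (simp add: lower_add_self B_def)
    qed
    then show ?iii by (intro conjI allI herm[OF tpsd])
  next
    assume ?iii
    then show "tpsd X b" by (intro from_sum) auto
  qed

  have i_iv: "tpsd X b \<longleftrightarrow> hermitian X B \<and> (\<forall>f g. max (?P f f) (?P g g) \<ge> ?P f g) \<and>
      (\<forall>x\<in>X. b x x = -\<infinity> \<longrightarrow> (\<forall>y\<in>X. b x y = -\<infinity>))"
    (is "_ \<longleftrightarrow> ?iv")
  proof
    assume tpsd: "tpsd X b"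
    show ?iv by (intro conjI allI herm[OF tpsd] le_max[OF tpsd] minf[OF tpsd])
  next
    assume iv: ?iv
    show "tpsd X b"
      by (rule from_max[OF iv[THEN conjunct1] iv[THEN conjunct2, THEN conjunct1, rule_format]
            iv[THEN conjunct2, THEN conjunct2]])
  qed

  have i_v: "tpsd X b \<longleftrightarrow> hermitian X B \<and>
      (\<forall>M\<ge>1. \<forall>f :: nat \<Rightarrow> 'a \<Rightarrow> ereal. f (M + 1) = f 1 \<longrightarrow>
        (\<Sum>m=1..M. ?P (f m) (f m)) \<ge> lower_sum (\<lambda>m. ?P (f m) (f (m + 1))) {1..M})"
    (is "_ \<longleftrightarrow> ?v")
  proof
    assume tpsd: "tpsd X b"
    show ?v
      unfolding B_def
      by (intro conjI allI impI tpsd_hermitian tpsd_duality_cyclic_sum_le tpsd)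
  next
    assume v: ?v
    have le: "?P f g +\<^sub>\<bottom> ?P g f \<le> ?P f f + ?P g g" for f g
    proof -
      let ?f = "\<lambda>m::nat. if m = 2 then g else f"
      have "lower_sum (\<lambda>m. ?P (?f m) (?f (m + 1))) {1..2} \<le> (\<Sum>m=1..2. ?P (?f m) (?f m))"
        using v[THEN conjunct2, rule_format, of 2 ?f] by simp
      then show ?thesis unfolding atLeastAtMost_1_2 by simp
    qed
    show "tpsd X b"
      by (rule from_sum[OF v[THEN conjunct1] le])
  qed

  have i_vi: "tpsd X b \<longleftrightarrow> hermitian X B \<and>
      (\<forall>M\<ge>1. \<forall>f :: nat \<Rightarrow> 'a \<Rightarrow> ereal. f (M + 1) = f 1 \<longrightarrow>
        (MAX m\<in>{1..M}. ?P (f m) (f m)) \<ge> (MAX m\<in>{1..M}. ?P (f m) (f (m + 1)))) \<and>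
      (\<forall>x\<in>X. b x x = -\<infinity> \<longrightarrow> (\<forall>y\<in>X. b x y = -\<infinity>))"
    (is "_ \<longleftrightarrow> ?vi")
  proof
    assume tpsd: "tpsd X b"
    have "(MAX m\<in>{1..M}. ?P (f m) (f (m + 1))) \<le> (MAX m\<in>{1..M}. ?P (f m) (f m))"
      if "M \<ge> 1" "f (M + 1) = f 1" for M and f :: "nat \<Rightarrow> 'a \<Rightarrow> ereal"
      by (rule Max_cyclic_le[where d = "\<lambda>m. ?P (f m) (f m)"]) (simp_all only: that le_max[OF tpsd])
    then show ?vi by (intro conjI allI impI herm[OF tpsd] minf[OF tpsd])
  next
    assume vi: ?vi
    have le: "?P f g \<le> max (?P f f) (?P g g)" for f g
    proof -
      let ?f = "\<lambda>m::nat. if m = 2 then g else f"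
      have "(MAX m\<in>{1..2}. ?P (?f m) (?f (m + 1))) \<le> (MAX m\<in>{1..2}. ?P (?f m) (?f m))"
        using vi[THEN conjunct2, THEN conjunct1, rule_format, of 2 ?f] by simp
      then show ?thesis unfolding atLeastAtMost_1_2 by simp
    qed
    show "tpsd X b"
      by (rule from_max[OF vi[THEN conjunct1] le vi[THEN conjunct2, THEN conjunct2]])
  qed

  from i_ii i_iii i_iv i_v i_vi show ?thesis
    by (rule conjI[OF _ conjI[OF _ conjI[OF _ conjI]]])
qed

end
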